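(* Let $a,b\ge 3$ and $k\ge 2$ be integers and let $G=CB(k,a,b)$ be the cycle barbell. Then \[ \mathscr{K}_{nb}(G)=\frac{2(a+b+k-1)^2+3(a+b)^2+2ab+4(a+b)(k-1)-(a+b+k-1)}{2(a+b+k-1)}. \]
   Context: The cycle barbell $CB(k,a,b)$ is the graph obtained from a cycle $C_a$, a path $P_k$ on $k$ vertices and a cycle $C_b$ by identifying one endpoint of the path with a vertex of $C_a$ and the other endpoint with a vertex of $C_b$. It has $a+b+k-2$ vertices and $a+b+k-1$ edges. Kemeny's constant of an irreducible finite Markov chain with transition matrix $P$ whose eigenvalues (with multiplicity) are $1=\rho_1,\rho_2,\dots,\rho_N$ (with $1$ simple) is $\mathscr{K}(P)=\sum_{i=2}^{N}\frac{1}{1-\rho_i}$. $\mathscr{K}_{nb}(G)$ is Kemeny's constant of the non-backtracking random walk on the arcs of $G$ (ordered pairs $(u,v)$ with $\{u,v\}$ an edge), where from $(u,v)$ one moves to $(v,w)$ with probability $1/(\deg(v)-1)$ for each neighbor $w\neq u$ of $v$. *)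

theory Defs
  imports "Jordan_Normal_Form.Char_Poly" "HOL-Library.Product_Lexorder"
begin

definition kemeny :: "complex mat \<Rightarrow> complex" where
  "kemeny P = (\<Sum>\<rho> \<in># proots (char_poly P) - {#1#}. 1 / (1 - \<rho>))"

text \<open>A simple graph is given by a finite vertex set V and a symmetric irreflexive
  adjacency predicate E.\<close>
definition gdeg :: "nat set \<Rightarrow> (nat \<Rightarrow> nat \<Rightarrow> bool) \<Rightarrow> nat \<Rightarrow> nat" where
  "gdeg V E v = card {w \<in> V. E v w}"

definition arcs :: "nat set \<Rightarrow> (nat \<Rightarrow> nat \<Rightarrow> bool) \<Rightarrow> (nat \<times> nat) set" where
  "arcs V E = {(u, v). u \<in> V \<and> v \<in> V \<and> E u v}"

text \<open>Transition matrix of the non-backtracking random walk on the arcs, arcs ordered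
  lexicographically (the ordering does not affect the spectrum).\<close>
definition nb_matrix :: "nat set \<Rightarrow> (nat \<Rightarrow> nat \<Rightarrow> bool) \<Rightarrow> real mat" where
  "nb_matrix V E =
    (let L = sorted_list_of_set (arcs V E); N = length L in
     mat N N (\<lambda>(i, j). let (u, v) = L ! i; (x, w) = L ! j in
        if x = v \<and> w \<noteq> u then 1 / (real (gdeg V E v) - 1) else 0))"

definition kemeny_nb :: "nat set \<Rightarrow> (nat \<Rightarrow> nat \<Rightarrow> bool) \<Rightarrow> complex" where
  "kemeny_nb V E = kemeny (map_mat complex_of_real (nb_matrix V E))"

text \<open>The cycle barbell CB(k,a,b) on vertices {0..<a+b+k-2}:
  cycle C_a on 0..a-1; path P_k on a-1, a, ..., a+k-2; cycle C_b on a+k-2, ..., a+b+k-3.\<close>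
definition cb_vertices :: "nat \<Rightarrow> nat \<Rightarrow> nat \<Rightarrow> nat set" where
  "cb_vertices k a b = {0..<a + b + k - 2}"

definition cb_edge_dir :: "nat \<Rightarrow> nat \<Rightarrow> nat \<Rightarrow> nat \<Rightarrow> nat \<Rightarrow> bool" where
  "cb_edge_dir k a b u v \<longleftrightarrow>
     (u < a \<and> v = (u + 1) mod a)
   \<or> (a - 1 \<le> u \<and> u < a + k - 2 \<and> v = u + 1)
   \<or> (a + k - 2 \<le> u \<and> u < a + k + b - 2 \<and>
        v = a + k - 2 + ((u - (a + k - 2) + 1) mod b))"

definition cb_adj :: "nat \<Rightarrow> nat \<Rightarrow> nat \<Rightarrow> nat \<Rightarrow> nat \<Rightarrow> bool" where
  "cb_adj k a b u v \<longleftrightarrow> cb_edge_dir k a b u v \<or> cb_edge_dir k a b v u"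

end

theory Submission
  imports Defs
begin

text \<open>Sorting the arcs into six chains -- the two orientations of each cycle, starting at its branch
  vertex, and the two orientations of the path -- makes the walk deterministic inside a chain, and at
  the end of a chain it picks one of two successor chains with probability $1/2$. Hence $x I - P$ is a
  triangular matrix minus a product of rank at most six, and Sylvester's identity contracts
  $\det (x I - P)$ to a $6 \times 6$ determinant in the chain lengths. With $\ell = k - 1$ and
  $u = (x^a - 1/2)(x^b - 1/2)$ this gives the characteristic polynomial
  $p = u (u x^{2 \ell} - 1/4)$. It has $1$ as a simple root, so Kemeny's constant is the logarithmic
  derivative of $p / (x - 1)$ at $1$, that is $p''(1) / (2 p'(1))$.\<close>

section \<open>Sums over the roots of a polynomial\<close>

text \<open>The sum is the logarithmic derivative of \<open>p\<close>: over the complex numbers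
  \<open>p\<close> splits into linear factors, the product rule yields one summand per factor, and
  the leading coefficient cancels.\<close>

lemma sum_proots_inverse_diff:
  fixes p :: "complex poly"
  assumes "poly p z \<noteq> 0"
  shows "(\<Sum>\<rho>\<in>#proots p. 1 / (z - \<rho>)) = poly (pderiv p) z / poly p z"
proof -
  have *: "(\<Sum>\<rho>\<in>#M. 1 / (z - \<rho>)) =
      poly (pderiv (\<Prod>\<rho>\<in>#M. [:-\<rho>, 1:])) z / poly (\<Prod>\<rho>\<in>#M. [:-\<rho>, 1:]) z"
    if "z \<notin># M" for M :: "complex multiset"
    using that
  proof (induction M)
    case (add r M)
    have "poly (\<Prod>\<rho>\<in>#M. [:-\<rho>, 1:]) z \<noteq> 0" "z \<noteq> r"
      using add.prems by (auto simp: poly_prod_mset)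
    moreover have "(\<Sum>\<rho>\<in>#M. 1 / (z - \<rho>)) =
        poly (pderiv (\<Prod>\<rho>\<in>#M. [:-\<rho>, 1:])) z / poly (\<Prod>\<rho>\<in>#M. [:-\<rho>, 1:]) z"
      using add by simp
    ultimately show ?case
      by (simp add: pderiv_mult pderiv_pCons add_divide_distrib del: mult_pCons_left)
  qed auto
  define c where "c = lead_coeff p"
  have "p \<noteq> 0" "c \<noteq> 0" using assms by (auto simp: c_def)
  have p: "Polynomial.smult c (\<Prod>\<rho>\<in>#proots p. [:-\<rho>, 1:]) = p"
    unfolding c_def by (rule complex_poly_decompose_multiset)
  have "poly (pderiv p) z = c * poly (pderiv (\<Prod>\<rho>\<in>#proots p. [:-\<rho>, 1:])) z"
    by (subst p[symmetric]) (simp only: pderiv_smult poly_smult)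
  moreover have "poly p z = c * poly (\<Prod>\<rho>\<in>#proots p. [:-\<rho>, 1:]) z"
    by (subst p[symmetric]) (simp only: poly_smult)
  ultimately show ?thesis using *[of "proots p"] assms \<open>p \<noteq> 0\<close> \<open>c \<noteq> 0\<close> by simp
qed

text \<open>Dividing out the root, p = (X - z) q gives p'(z) = q(z) and p''(z) = 2 q'(z), and q has
  exactly the remaining roots.\<close>

lemma sum_proots_inverse_diff_simple_root:
  fixes p :: "complex poly"
  assumes "poly p z = 0" and "poly (pderiv p) z \<noteq> 0"
  shows "(\<Sum>\<rho>\<in>#proots p - {#z#}. 1 / (z - \<rho>)) =
    poly (pderiv (pderiv p)) z / (2 * poly (pderiv p) z)"
proof -
  obtain q where p: "p = [:-z, 1:] * q" using assms(1) by (auto simp: poly_eq_0_iff_dvd elim: dvdE)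
  have q: "poly (pderiv p) z = poly q z" "poly (pderiv (pderiv p)) z = 2 * poly (pderiv q) z"
    unfolding p by (simp_all add: pderiv_mult pderiv_pCons pderiv_add del: mult_pCons_left)
  then have "q \<noteq> 0" using assms by auto
  then have "proots p - {#z#} = proots q" unfolding p by (subst proots_mult) (auto simp del: mult_pCons_left)
  then show ?thesis using sum_proots_inverse_diff[of q z] q assms by simp
qed

section \<open>Contraction of determinants\<close>

lemma poly_char_poly:
  assumes "A \<in> carrier_mat n n"
  shows "poly (char_poly A) x = det (x \<cdot>\<^sub>m 1\<^sub>m n - A)"
proof -
  have "map_mat (\<lambda>p. poly p x) (char_poly_matrix A) = x \<cdot>\<^sub>m 1\<^sub>m n - A"
    using assms by (intro eq_matI) (auto simp: char_poly_matrix_def)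
  then show ?thesis
    using comm_ring_hom.hom_det[of "\<lambda>p. poly p x" "char_poly_matrix A"]
    unfolding char_poly_def by (auto intro: comm_ring_hom.intro simp: poly_hom.comm_ring_hom_axioms)
qed

text \<open>Two enumerations differ by a permutation. It acts on the rows and, after a
  transposition, on the columns, so its sign enters squared.\<close>

lemma det_reindex:
  fixes F :: "'b \<Rightarrow> 'b \<Rightarrow> 'a :: comm_ring_1"
  assumes f: "bij_betw f {0..<n} S" and g: "bij_betw g {0..<n} S"
  shows "det (mat n n (\<lambda>(i,j). F (f i) (f j))) = det (mat n n (\<lambda>(i,j). F (g i) (g j)))"
proof -
  \<comment> \<open>Outside the index range \<open>p\<close> is the identity, as
    \<open>permutes\<close> demands.\<close>
  define p where "p i = (if i \<in> {0..<n} then inv_into {0..<n} g (f i) else i)" for i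
  have "bij_betw (inv_into {0..<n} g \<circ> f) {0..<n} {0..<n}"
    using bij_betw_trans[OF f bij_betw_inv_into[OF g]] .
  then have "bij_betw p {0..<n} {0..<n}"
    by (rule bij_betw_cong[THEN iffD1, rotated]) (simp add: p_def)
  then have p: "p permutes {0..<n}"
    by (rule bij_imp_permutes) (auto simp: p_def)
  have gp: "g (p i) = f i" if "i < n" for i
    using that f g by (auto simp: p_def bij_betw_def intro!: f_inv_into_f)
  have pn: "p i < n" if "i < n" for i using permutes_in_image[OF p, of i] that by simp
  let ?G = "mat n n (\<lambda>(i,j). F (g i) (g j))"
  let ?H = "mat n n (\<lambda>(i,j). ?G $$ (p i, j))"
  let ?K = "mat n n (\<lambda>(i,j). transpose_mat ?H $$ (p i, j))"
  have sq: "signof p * signof p = (1 :: 'a)"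
    by (simp add: sign_def)
  have "mat n n (\<lambda>(i,j). F (f i) (f j)) = transpose_mat ?K"
    by (rule eq_matI) (auto simp: gp pn)
  then have "det (mat n n (\<lambda>(i,j). F (f i) (f j))) = det ?K"
    using det_transpose[of ?K n] by auto
  also have "\<dots> = signof p * det (transpose_mat ?H)"
    by (rule det_permute_rows[OF _ p]) auto
  also have "det (transpose_mat ?H) = det ?H" by (rule det_transpose[of _ n]) auto
  also have "det ?H = signof p * det ?G"
    by (rule det_permute_rows[OF _ p]) auto
  finally show ?thesis using sq by (simp flip: mult.assoc)
qed

text \<open>Sylvester's identity. Multiplying \<open>?B\<close> by the unipotent \<open>?L\<close>
  on either side clears the lower left block; the two block triangular products have equal
  determinants.\<close>

lemma det_one_minus_mult_commute:
  fixes U :: "'a :: idom mat"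
  assumes U: "U \<in> carrier_mat n m" and V: "V \<in> carrier_mat m n"
  shows "det (1\<^sub>m n - U * V) = det (1\<^sub>m m - V * U)"
proof -
  let ?B = "four_block_mat (1\<^sub>m n) U V (1\<^sub>m m)"
  let ?L = "four_block_mat (1\<^sub>m n) (0\<^sub>m n m) (- V) (1\<^sub>m m)"
  have "?B * ?L = four_block_mat (1\<^sub>m n - U * V) U (0\<^sub>m m n) (1\<^sub>m m)"
    using U V by (subst mult_four_block_mat[of _ n n _ m _ m _ _ n _ m])
      (auto intro!: cong_four_block_mat)
  moreover have "?L * ?B = four_block_mat (1\<^sub>m n) U (0\<^sub>m m n) (1\<^sub>m m - V * U)"
    using U V by (subst mult_four_block_mat[of _ n n _ m _ m _ _ n _ m])
      (auto intro!: cong_four_block_mat)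
  moreover have "det (?B * ?L) = det (?L * ?B)"
    using U V by (simp add: det_mult[of _ "n + m"] mult.commute)
  moreover have "det (four_block_mat (1\<^sub>m n - U * V) U (0\<^sub>m m n) (1\<^sub>m m)) = det (1\<^sub>m n - U * V)"
    using U V by (subst det_four_block_mat_lower_left_zero[of _ n _ m]) auto
  moreover have "det (four_block_mat (1\<^sub>m n) U (0\<^sub>m m n) (1\<^sub>m m - V * U)) = det (1\<^sub>m m - V * U)"
    using U V by (subst det_four_block_mat_lower_left_zero[of _ n _ m]) auto
  ultimately show ?thesis by simp
qed

text \<open>Index \<open>i\<close> is position \<open>pos i\<close> of chain \<open>ch i\<close>,
  and \<open>T\<close> leads from \<open>e c\<close> to chain starts. The matrix is
  \<open>D - U * W\<close> with \<open>D\<close> bidiagonal; putting V = W D^-1 turns it into (1 - U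
  V) D, and Sylvester's identity moves the determinant to size \<open>r\<close>.\<close>

lemma det_chain_contraction:
  fixes x :: "'a :: field" and T :: "nat \<Rightarrow> nat \<Rightarrow> 'a"
  assumes x: "x \<noteq> 0"
    and ch: "\<And>i. i < n \<Longrightarrow> ch i < r"
    and prev: "\<And>i. i < n \<Longrightarrow> pos i \<noteq> 0 \<Longrightarrow> 0 < i \<and> ch (i - 1) = ch i \<and> pos i = Suc (pos (i - 1))"
    and e: "\<And>c. c < r \<Longrightarrow> e c < n \<and> ch (e c) = c"
  shows "det (mat n n (\<lambda>(i,j). (if i = j then x else 0) - (if j = Suc i \<and> pos j \<noteq> 0 then 1 else 0)
      - (if i = e (ch i) \<and> pos j = 0 then T (ch i) (ch j) else 0)))
    = x ^ n * det (mat r r (\<lambda>(c,d). (if c = d then 1 else 0) - T c d / x ^ Suc (pos (e c))))"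
    (is "det ?M = _ * det ?R")
proof -
  define D where "D = mat n n (\<lambda>(i,j). (if i = j then x else 0) - (if j = Suc i \<and> pos j \<noteq> 0 then 1 else 0))"
  define U where "U = mat n r (\<lambda>(i,d). if i = e (ch i) then T (ch i) d else 0)"
  \<comment> \<open>This is \<open>W\<close> times the inverse of \<open>D\<close>: one factor 1/x
    per position counted from the chain start, so that multiplication by \<open>D\<close>
    telescopes.\<close>
  define V where "V = mat r n (\<lambda>(c,j). if ch j = c then 1 / x ^ Suc (pos j) else 0)"
  define W where "W = mat r n (\<lambda>(c,j). if ch j = c \<and> pos j = 0 then 1 else 0 :: 'a)"
  have car: "D \<in> carrier_mat n n" "U \<in> carrier_mat n r" "V \<in> carrier_mat r n" "W \<in> carrier_mat r n"
    by (auto simp: D_def U_def V_def W_def)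
  have "det D = prod_list (diag_mat D)"
    by (rule det_upper_triangular[OF _ car(1)]) (auto simp: upper_triangular_def D_def)
  also have "diag_mat D = replicate n x"
    by (auto simp: diag_mat_def D_def list_eq_iff_nth_eq)
  finally have detD: "det D = x ^ n" by simp
  have VD: "V * D = W"
  proof (rule eq_matI)
    fix c j assume "c < dim_row W" "j < dim_col W"
    then have cj: "c < r" "j < n" by (auto simp: W_def)
    have "(V * D) $$ (c, j) = (\<Sum>i<n. V $$ (c, i) * D $$ (i, j))"
      using cj car by (simp add: scalar_prod_def atLeast0LessThan)
    also have "\<dots> = (\<Sum>i<n. (if i = j then V $$ (c, j) * x else 0)
        - (if j = Suc i \<and> pos j \<noteq> 0 then V $$ (c, i) else 0))"
      using cj by (intro sum.cong) (auto simp: D_def algebra_simps)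
    also have "\<dots> = V $$ (c, j) * x - (if pos j \<noteq> 0 then V $$ (c, j - 1) else 0)"
    proof (cases "pos j = 0")
      case False
      then have "(\<Sum>i<n. if j = Suc i \<and> pos j \<noteq> 0 then V $$ (c, i) else 0)
          = (\<Sum>i<n. if i = j - 1 then V $$ (c, i) else 0)"
        using prev[OF cj(2)] by (intro sum.cong) auto
      then show ?thesis using cj False by (simp add: sum_subtractf)
    qed (use cj in \<open>simp add: sum_subtractf\<close>)
    also have "\<dots> = W $$ (c, j)"
      using cj prev[OF cj(2)] x by (auto simp: V_def W_def)
    finally show "(V * D) $$ (c, j) = W $$ (c, j)" .
  qed (use car in auto)
  have VU: "1\<^sub>m r - V * U = ?R"
  proof (rule eq_matI)
    fix c d assume "c < dim_row ?R" "d < dim_col ?R"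
    then have cd: "c < r" "d < r" by auto
    have "(V * U) $$ (c, d) = (\<Sum>i<n. V $$ (c, i) * U $$ (i, d))"
      using cd car by (simp add: scalar_prod_def atLeast0LessThan)
    also have "\<dots> = (\<Sum>i<n. if i = e c then T c d / x ^ Suc (pos (e c)) else 0)"
      using cd e by (intro sum.cong) (auto simp: V_def U_def)
    also have "\<dots> = T c d / x ^ Suc (pos (e c))" using e cd by simp
    finally show "(1\<^sub>m r - V * U) $$ (c, d) = ?R $$ (c, d)" using cd car by simp
  qed (use car in auto)
  have UW: "?M = D - U * W"
  proof (rule eq_matI)
    fix i j assume "i < dim_row (D - U * W)" "j < dim_col (D - U * W)"
    then have ij: "i < n" "j < n" using car by auto
    have "(U * W) $$ (i, j) = (\<Sum>c<r. U $$ (i, c) * W $$ (c, j))"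
      using ij car by (simp add: scalar_prod_def atLeast0LessThan)
    also have "\<dots> = (\<Sum>c<r. if c = ch j then (if i = e (ch i) \<and> pos j = 0 then T (ch i) (ch j) else 0) else 0)"
      using ij by (intro sum.cong) (auto simp: W_def U_def)
    also have "\<dots> = (if i = e (ch i) \<and> pos j = 0 then T (ch i) (ch j) else 0)"
      using ch ij by simp
    finally show "?M $$ (i, j) = (D - U * W) $$ (i, j)" using ij car by (simp add: D_def)
  qed (use car in auto)
  have "D - U * W = (1\<^sub>m n - U * V) * D"
    using car by (simp add: VD[symmetric] minus_mult_distrib_mat[of _ n n] assoc_mult_mat[of _ n r _ n])
  moreover have "1\<^sub>m n - U * V \<in> carrier_mat n n"
    using car by auto
  ultimately have "det ?M = det (1\<^sub>m n - U * V) * det D"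
    unfolding UW using car by (simp add: det_mult[of _ n])
  then show ?thesis
    using car by (simp add: detD VU det_one_minus_mult_commute[of U n r V])
qed

section \<open>Indices cut into consecutive blocks\<close>

definition block_offset :: "(nat \<Rightarrow> nat) \<Rightarrow> nat \<Rightarrow> nat" where
  "block_offset len c = (\<Sum>d<c. len d)"

text \<open>The index \<open>block_offset len c + p\<close> with \<open>p < len c\<close> encodes
  the pair (c, p); \<open>block_of\<close> and \<open>block_pos\<close> decode it.\<close>

definition block_of :: "(nat \<Rightarrow> nat) \<Rightarrow> nat \<Rightarrow> nat" where
  "block_of len i = (LEAST c. i < block_offset len (Suc c))"

definition block_pos :: "(nat \<Rightarrow> nat) \<Rightarrow> nat \<Rightarrow> nat" where
  "block_pos len i = i - block_offset len (block_of len i)"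

lemma block_offset_Suc: "block_offset len (Suc c) = block_offset len c + len c"
  by (simp add: block_offset_def)

lemma block_offset_mono: "c \<le> d \<Longrightarrow> block_offset len c \<le> block_offset len d"
  unfolding block_offset_def by (rule sum_mono2) auto

lemma block_of_offset_plus:
  assumes "p < len c"
  shows "block_of len (block_offset len c + p) = c" "block_pos len (block_offset len c + p) = p"
proof -
  show "block_of len (block_offset len c + p) = c"
    unfolding block_of_def
  proof (rule Least_equality)
    show "block_offset len c + p < block_offset len (Suc c)" using assms by (simp add: block_offset_Suc)
  next
    fix d assume d: "block_offset len c + p < block_offset len (Suc d)"
    show "c \<le> d"
    proof (rule ccontr)
      assume "\<not> c \<le> d"
      then have "block_offset len (Suc d) \<le> block_offset len c" by (intro block_offset_mono) simp
      then show False using d by simp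
    qed
  qed
  then show "block_pos len (block_offset len c + p) = p" by (simp add: block_pos_def)
qed

lemma block_decomposition:
  assumes "i < block_offset len r"
  shows "block_of len i < r" "block_pos len i < len (block_of len i)"
    "block_offset len (block_of len i) + block_pos len i = i"
proof -
  define c where "c = block_of len i"
  obtain s where r: "r = Suc s" using assms by (cases r) (auto simp: block_offset_def)
  have up: "i < block_offset len (Suc c)"
    unfolding c_def block_of_def by (rule LeastI[of _ s]) (use assms r in simp)
  have "c \<le> s"
    unfolding c_def block_of_def by (rule Least_le) (use assms r in simp)
  then show "block_of len i < r" by (simp add: c_def r)
  have lo: "block_offset len c \<le> i"
  proof (cases c)
    case (Suc d)
    then have "\<not> i < block_offset len (Suc d)"
      unfolding c_def block_of_def by (intro not_less_Least) simp
    then show ?thesis using Suc by simp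
  qed (simp add: block_offset_def)
  then show "block_offset len (block_of len i) + block_pos len i = i"
    by (simp add: block_pos_def c_def)
  show "block_pos len i < len (block_of len i)"
    using up lo by (simp add: block_pos_def block_offset_Suc flip: c_def)
qed

text \<open>The contraction in (chain, position) coordinates, the form in which the walk is
  described later. Moving on inside a block is the same as going to the next index without landing
  on position 0.\<close>

lemma det_blocks_contraction:
  fixes x :: "'a :: field" and T :: "nat \<Rightarrow> nat \<Rightarrow> 'a"
  assumes x: "x \<noteq> 0" and len: "\<And>c. c < r \<Longrightarrow> 0 < len c"
  defines "n \<equiv> block_offset len r" and "ch \<equiv> block_of len" and "pos \<equiv> block_pos len"
  shows "det (mat n n (\<lambda>(i,j). (if i = j then x else 0)
      - (if ch j = ch i \<and> pos j = Suc (pos i) then 1 else 0)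
      - (if Suc (pos i) = len (ch i) \<and> pos j = 0 then T (ch i) (ch j) else 0)))
    = x ^ n * det (mat r r (\<lambda>(c,d). (if c = d then 1 else 0) - T c d / x ^ len c))"
proof -
  \<comment> \<open>The last index of block \<open>c\<close>; since \<open>len c\<close> is
    positive, the subtraction is not truncated.\<close>
  define e where "e c = block_offset len c + (len c - 1)" for c
  have dec: "ch i < r" "pos i < len (ch i)" "block_offset len (ch i) + pos i = i" if "i < n" for i
    using block_decomposition[of i len r] that unfolding n_def ch_def pos_def by auto
  have prev: "0 < i \<and> ch (i - 1) = ch i \<and> pos i = Suc (pos (i - 1))" if "i < n" "pos i \<noteq> 0" for i
  proof -
    have "i - 1 = block_offset len (ch i) + (pos i - 1)" "pos i - 1 < len (ch i)" "0 < i"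
      using dec[OF that(1)] that(2) by linarith+
    then show ?thesis
      using block_of_offset_plus[of "pos i - 1" len "ch i"] that(2) unfolding ch_def pos_def by simp
  qed
  have ech: "e c < n \<and> ch (e c) = c" "Suc (pos (e c)) = len c" if "c < r" for c
  proof -
    have "block_offset len (Suc c) \<le> n" unfolding n_def using that by (intro block_offset_mono) simp
    then show "e c < n \<and> ch (e c) = c" "Suc (pos (e c)) = len c"
      using block_of_offset_plus[of "len c - 1" len c] len[OF that]
      unfolding e_def ch_def pos_def block_offset_Suc by auto
  qed
  have step: "ch j = ch i \<and> pos j = Suc (pos i) \<longleftrightarrow> j = Suc i \<and> pos j \<noteq> 0" if "i < n" "j < n" for i j
    using prev[OF that(2)] dec(3)[OF that(1)] dec(3)[OF that(2)]
    by (metis add_Suc_right diff_Suc_1 nat.distinct(1))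
  have last: "Suc (pos i) = len (ch i) \<longleftrightarrow> i = e (ch i)" if "i < n" for i
    using dec[OF that] len unfolding e_def by (metis Suc_pred add_left_cancel diff_Suc_1)
  have "mat n n (\<lambda>(i,j). (if i = j then x else 0)
      - (if ch j = ch i \<and> pos j = Suc (pos i) then 1 else 0)
      - (if Suc (pos i) = len (ch i) \<and> pos j = 0 then T (ch i) (ch j) else 0))
    = mat n n (\<lambda>(i,j). (if i = j then x else 0) - (if j = Suc i \<and> pos j \<noteq> 0 then 1 else 0)
      - (if i = e (ch i) \<and> pos j = 0 then T (ch i) (ch j) else 0))"
    by (intro eq_matI) (simp_all only: index_mat dim_row_mat dim_col_mat split step last)
  moreover have "mat r r (\<lambda>(c,d). (if c = d then 1 else 0) - T c d / x ^ len c)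
      = mat r r (\<lambda>(c,d). (if c = d then 1 else 0) - T c d / x ^ Suc (pos (e c)))"
    by (intro eq_matI) (simp_all add: ech(2) del: power_Suc)
  ultimately show ?thesis
    using det_chain_contraction[of x n ch r pos e T] x dec(1) prev ech(1) by presburger
qed

text \<open>Laplace expansion along the first row, with the minors again in \<open>mat\<close> form
  so that rewriting can iterate it.\<close>

lemma det_mat_Suc:
  fixes f :: "nat \<times> nat \<Rightarrow> 'a :: comm_ring_1"
  shows "det (mat (Suc n) (Suc n) f) =
    (\<Sum>j<Suc n. f (0, j) * ((-1) ^ j * det (mat n n (\<lambda>(i, k). f (Suc i, if k < j then k else Suc k)))))"
proof -
  let ?A = "mat (Suc n) (Suc n) f"
  have "mat_delete ?A 0 j = mat n n (\<lambda>(i, k). f (Suc i, if k < j then k else Suc k))" if "j < Suc n" for j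
    using that by (intro eq_matI) (auto simp: mat_delete_def)
  then show ?thesis
    by (subst laplace_expansion_row[of _ "Suc n" 0]) (auto simp: cofactor_def)
qed

section \<open>The arc chains of the cycle barbell\<close>

text \<open>The chains are numbered as follows: 0 and 1 are the two orientations of $C_a$, 2 and 3 those
  of $C_b$, 4 is the path from $C_a$ to $C_b$, and 5 is the path back.\<close>
definition chain_succ :: "(nat \<times> nat) set" where
  "chain_succ = {(0,0), (0,4), (1,1), (1,4), (2,2), (2,5), (3,3), (3,5), (4,2), (4,3), (5,0), (5,1)}"

text \<open>Used as a congruence rule, this keeps the simplifier out of the minors until they are expanded.\<close>
lemma mat_weak_cong: "mat n m f = mat n m f" by simp

text \<open>The two orientations of a cycle have equal weight. Their antisymmetric combinations
  split off the first two factors; in the symmetric quotient the term with 4 is the closed tour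
  through both cycles and both path directions, with two orientations to choose on each
  cycle.\<close>

lemma det_contracted_chains:
  fixes w :: "nat \<Rightarrow> 'a :: comm_ring_1"
  assumes "w 1 = w 0" and "w 3 = w 2"
  shows "det (mat 6 6 (\<lambda>(c,d). (if c = d then 1 else 0) - (if (c,d) \<in> chain_succ then w c else 0)))
    = (1 - w 0) * (1 - w 2) * ((1 - w 0) * (1 - w 2) - 4 * w 0 * w 2 * w 4 * w 5)"
proof -
  have six: "(6::nat) = Suc (Suc (Suc (Suc (Suc (Suc 0)))))" by simp
  have w: "w (Suc 0) = w 0" "w (Suc (Suc (Suc 0))) = w (Suc (Suc 0))"
    using assms by (simp_all add: numeral_eq_Suc)
  have v: "w 2 = w (Suc (Suc 0))" "w 4 = w (Suc (Suc (Suc (Suc 0))))" "w 5 = w (Suc (Suc (Suc (Suc (Suc 0)))))"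
    by (simp_all add: numeral_eq_Suc)
  show ?thesis
    unfolding six v
    \<comment> \<open>Simplifying after each expansion discards the minors with coefficient 0 before
      the next one.\<close>
    apply (simp only: det_mat_Suc[of "Suc (Suc (Suc (Suc (Suc 0))))"] cong: mat_weak_cong)
    apply (simp add: chain_succ_def lessThan_Suc w cong: mat_weak_cong)
    apply (simp only: det_mat_Suc[of "Suc (Suc (Suc (Suc 0)))"] cong: mat_weak_cong)
    apply (simp add: chain_succ_def lessThan_Suc w cong: mat_weak_cong)
    apply (simp only: det_mat_Suc[of "Suc (Suc (Suc 0))"] cong: mat_weak_cong)
    apply (simp add: chain_succ_def lessThan_Suc w cong: mat_weak_cong)
    apply (simp only: det_mat_Suc[of "Suc (Suc 0)"] cong: mat_weak_cong)
    apply (simp add: chain_succ_def lessThan_Suc w cong: mat_weak_cong)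
    apply (simp only: det_mat_Suc[of "Suc 0"] cong: mat_weak_cong)
    apply (simp add: chain_succ_def lessThan_Suc w cong: mat_weak_cong)
    apply (simp only: det_mat_Suc[of 0] cong: mat_weak_cong)
    apply (simp add: chain_succ_def lessThan_Suc w cong: mat_weak_cong)
    apply (simp add: algebra_simps)
    done
qed

text \<open>To avoid truncated subtraction, the parameters are $l = k - 1$, $m = a - 1$ and $n = b - 1$; the
  branch vertices are then $m$ and $m + l$, and $m + l + n$ is the largest vertex.\<close>
context
  fixes l m n :: nat
begin

definition chain_len :: "nat \<Rightarrow> nat" where
  "chain_len c = (if c < 2 then Suc m else if c < 4 then Suc n else l)"

text \<open>The cases on \<open>p\<close> in the first four chains single out the closing edges {0,
  m} and {m + l, m + l + n}. The branch vertex has the largest label on one cycle and the smallest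
  on the other, so the closing arc comes first in chains 0 and 3 and last in chains 1 and 2.\<close>

definition chain_arc :: "nat \<Rightarrow> nat \<Rightarrow> nat \<times> nat" where
  "chain_arc c p =
    (if c = 0 then (if p = 0 then m else p - 1, p)
    else if c = 1 then (m - p, if p = m then m else m - p - 1)
    else if c = 2 then (m + l + p, if p = n then m + l else m + l + p + 1)
    else if c = 3 then (if p = 0 then m + l else m + l + n + 1 - p, m + l + n - p)
    else if c = 4 then (m + p, m + p + 1)
    else (m + l - p, m + l - p - 1))"

definition is_chain_arc :: "nat \<Rightarrow> nat \<Rightarrow> nat \<Rightarrow> nat \<Rightarrow> bool" where
  "is_chain_arc c p u v \<longleftrightarrow> c < 6 \<and> p < chain_len c \<and> chain_arc c p = (u, v)"

text \<open>A form free of subtraction, so that the case analyses below reduce to linear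
  arithmetic.\<close>

lemma is_chain_arc_iff:
  "is_chain_arc c p u v \<longleftrightarrow>
    (c = 0 \<and> p = 0 \<and> u = m \<and> v = 0) \<or>
    (c = 0 \<and> p \<le> m \<and> p = Suc u \<and> v = p) \<or>
    (c = 1 \<and> p = m \<and> u = 0 \<and> v = m) \<or>
    (c = 1 \<and> u + p = m \<and> u = Suc v) \<or>
    (c = 2 \<and> p = n \<and> u = m + l + n \<and> v = m + l) \<or>
    (c = 2 \<and> p < n \<and> u = m + l + p \<and> v = Suc u) \<or>
    (c = 3 \<and> p = 0 \<and> u = m + l \<and> v = m + l + n) \<or>
    (c = 3 \<and> 0 < p \<and> p \<le> n \<and> v + p = m + l + n \<and> u = Suc v) \<or>
    (c = 4 \<and> p < l \<and> u = m + p \<and> v = Suc u) \<or>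
    (c = 5 \<and> p < l \<and> u + p = m + l \<and> u = Suc v)"
proof -
  consider "c = 0" | "c = 1" | "c = 2" | "c = 3" | "c = 4" | "c = 5" | "c \<ge> 6" by linarith
  then show ?thesis
  proof cases
    case 1
    then show ?thesis by (cases p) (auto simp: is_chain_arc_def chain_len_def chain_arc_def)
  next
    case 2
    show ?thesis
      unfolding is_chain_arc_def chain_len_def chain_arc_def 2 by (cases "p < m") auto
  next
    case 3
    then show ?thesis by (auto simp: is_chain_arc_def chain_len_def chain_arc_def)
  next
    case 4
    show ?thesis
      unfolding is_chain_arc_def chain_len_def chain_arc_def 4 by (cases p) auto
  next
    case 5
    then show ?thesis by (auto simp: is_chain_arc_def chain_len_def chain_arc_def)
  next
    case 6
    then show ?thesis by (auto simp: is_chain_arc_def chain_len_def chain_arc_def)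
  next
    case 7
    then show ?thesis by (auto simp: is_chain_arc_def)
  qed
qed

end

section \<open>Transitions between arcs in chain coordinates\<close>

context
  fixes l m n :: nat
  assumes m: "m \<ge> 2" and n: "n \<ge> 2" and l: "l \<ge> 1"
begin

text \<open>Cycle length at least 3 enters here: on two vertices, the closing arc would coincide
  with an arc of the opposite orientation.\<close>

lemma is_chain_arc_inj:
  assumes "is_chain_arc l m n c p u v" and "is_chain_arc l m n d q u v"
  shows "c = d \<and> p = q"
  using assms unfolding is_chain_arc_iff
  by (elim disjE conjE; use m n l in \<open>intro conjI; linarith\<close>)

text \<open>This and the next three lemmas list the arcs at the branch vertices with their far
  endpoints, so that backtracking can be detected by comparing endpoints.\<close>

lemma is_chain_arc_into_m:
  assumes "is_chain_arc l m n c p u m"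
  shows "c = 0 \<and> p = m \<and> u = m - 1 \<or> c = 1 \<and> p = m \<and> u = 0 \<or> c = 5 \<and> Suc p = l \<and> u = m + 1"
  using assms m n l unfolding is_chain_arc_iff
  by - ((elim disjE conjE; (rule FalseE, linarith)?), simp_all)

lemma is_chain_arc_from_m:
  assumes "is_chain_arc l m n c p m v"
  shows "c = 0 \<and> p = 0 \<and> v = 0 \<or> c = 1 \<and> p = 0 \<and> v = m - 1 \<or> c = 4 \<and> p = 0 \<and> v = m + 1"
  using assms m n l unfolding is_chain_arc_iff
  by - ((elim disjE conjE; (rule FalseE, linarith)?), simp_all)

lemma is_chain_arc_into_ml:
  assumes "is_chain_arc l m n c p u (m + l)"
  shows "c = 2 \<and> p = n \<and> u = m + l + n \<or> c = 3 \<and> p = n \<and> u = m + l + 1 \<or> c = 4 \<and> Suc p = l \<and> u = m + l - 1"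
  using assms m n l unfolding is_chain_arc_iff
  by - ((elim disjE conjE; (rule FalseE, linarith)?), simp_all)

lemma is_chain_arc_from_ml:
  assumes "is_chain_arc l m n c p (m + l) v"
  shows "c = 2 \<and> p = 0 \<and> v = m + l + 1 \<or> c = 3 \<and> p = 0 \<and> v = m + l + n \<or> c = 5 \<and> p = 0 \<and> v = m + l - 1"
  using assms m n l unfolding is_chain_arc_iff
  by - ((elim disjE conjE; (rule FalseE, linarith)?), simp_all)

lemma is_chain_arc_start:
  assumes "is_chain_arc l m n c 0 u v"
  shows "(c = 0 \<or> c = 1 \<or> c = 4) \<and> u = m \<or> (c = 2 \<or> c = 3 \<or> c = 5) \<and> u = m + l"
  using assms m n l unfolding is_chain_arc_iff
  by - ((elim disjE conjE; (rule FalseE, linarith)?), simp_all)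

lemma is_chain_arc_end:
  assumes "is_chain_arc l m n c p u v" and "Suc p = chain_len l m n c"
  shows "v = m \<or> v = m + l"
proof -
  have "v = m" if "c < 2" "p = m"
    using assms(1) that m n l unfolding is_chain_arc_iff by (elim disjE conjE; linarith)
  moreover have "v = m + l" if "c \<ge> 2" "c < 4" "p = n"
    using assms(1) that m n l unfolding is_chain_arc_iff by (elim disjE conjE; linarith)
  moreover have "v = m + l" if "c = 4" "Suc p = l"
    using assms(1) that m n l unfolding is_chain_arc_iff by (elim disjE conjE; linarith)
  moreover have "v = m" if "c > 4" "Suc p = l"
    using assms(1) that m n l unfolding is_chain_arc_iff by (elim disjE conjE; linarith)
  ultimately show ?thesis
    using assms(2) linorder_less_linear[of c 4] by (cases "c < 2") (auto simp: chain_len_def)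
qed

text \<open>Chains are cut exactly at the vertices of degree 3, so the position of an arc determines
  its transition probabilities.\<close>

lemma is_chain_arc_end_iff:
  assumes "is_chain_arc l m n c p u v"
  shows "Suc p = chain_len l m n c \<longleftrightarrow> v = m \<or> v = m + l"
proof
  assume "v = m \<or> v = m + l"
  then have "(c = 0 \<or> c = 1) \<and> p = m \<or> (c = 2 \<or> c = 3) \<and> p = n \<or> (c = 4 \<or> c = 5) \<and> Suc p = l"
    using is_chain_arc_into_m[of c p u] is_chain_arc_into_ml[of c p u] assms by blast
  then show "Suc p = chain_len l m n c" by (elim disjE conjE) (simp_all add: chain_len_def)
qed (rule is_chain_arc_end[OF assms])

text \<open>At a vertex of degree 2 the only exit that avoids the reversal continues the
  chain.\<close>

lemma is_chain_arc_next:
  assumes "is_chain_arc l m n c p u v" and "is_chain_arc l m n d q v w"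
    and "w \<noteq> u" and "v \<noteq> m" and "v \<noteq> m + l"
  shows "d = c \<and> q = Suc p"
proof -
  \<comment> \<open>The disequalities among the hypotheses are split into order cases, which linear
    arithmetic can use.\<close>
  have A: "d = c \<and> q = Suc p" if "v < m \<or> m < v \<and> v < m + l \<or> m + l < v" "w < u"
    using assms(1,2) that m n l unfolding is_chain_arc_iff
    by - (elim disjE conjE; intro conjI; linarith)
  have B: "d = c \<and> q = Suc p" if "v < m \<or> m < v \<and> v < m + l \<or> m + l < v" "u < w"
    using assms(1,2) that m n l unfolding is_chain_arc_iff
    by - (elim disjE conjE; intro conjI; linarith)
  show ?thesis using A B assms(3-) by linarith
qed

lemma is_chain_arc_Suc:
  assumes "is_chain_arc l m n c p u v" and "is_chain_arc l m n c (Suc p) x w"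
  shows "x = v" "w \<noteq> u"
proof -
  show "x = v"
    using assms unfolding is_chain_arc_iff
    by (elim disjE conjE; use m n l in linarith)
  show "w \<noteq> u"
    using assms unfolding is_chain_arc_iff
    by (elim disjE conjE; use m n l in linarith)
qed

text \<open>Of the three exits from a branch vertex, the ban on reversal leaves two, recorded in
  \<open>chain_succ\<close>; elsewhere the walk is deterministic.\<close>

lemma chain_transition_iff:
  assumes cp: "is_chain_arc l m n c p u v" and dq: "is_chain_arc l m n d q x w"
  shows "x = v \<and> w \<noteq> u \<longleftrightarrow>
    (d = c \<and> q = Suc p) \<or> (Suc p = chain_len l m n c \<and> q = 0 \<and> (c, d) \<in> chain_succ)"
proof -
  have q: "q < chain_len l m n d" using dq by (simp add: is_chain_arc_def)
  consider "v = m" | "v = m + l" | "v \<noteq> m" "v \<noteq> m + l" by blast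
  then show ?thesis
  proof cases
    case 1
    then have e: "Suc p = chain_len l m n c" using is_chain_arc_end_iff[OF cp] by blast
    \<comment> \<open>With an opaque name for the branch vertex, the reversed arcs are recognized by
      syntactically equal endpoints.\<close>
    obtain s where s: "s = m" by simp
    have c: "c = 0 \<and> u = s - 1 \<or> c = 1 \<and> u = 0 \<or> c = 5 \<and> u = s + 1"
      using is_chain_arc_into_m[of c p u] cp 1 unfolding s by blast
    have d: "d = 0 \<and> q = 0 \<and> w = 0 \<or> d = 1 \<and> q = 0 \<and> w = s - 1 \<or> d = 4 \<and> q = 0 \<and> w = s + 1"
      if "x = s"
      using is_chain_arc_from_m[of d q w] dq that unfolding s by blast
    have "q = 0 \<and> (c, d) \<in> chain_succ" if "x = s" "w \<noteq> u"
      using d[OF that(1)] c that(2) by (elim disjE conjE) (simp_all add: chain_succ_def)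
    moreover have "x = s \<and> w \<noteq> u" if q: "q = 0" and "(c, d) \<in> chain_succ"
    proof -
      have c': "c = 0 \<or> c = 1 \<or> c = 5" using c by blast
      have "(c, d) \<in> {(0,0), (0,4), (1,1), (1,4), (5,0), (5,1)}"
        using c' that(2) unfolding chain_succ_def by (elim disjE) simp_all
      then have cd: "c = 0 \<and> d = 0 \<or> c = 0 \<and> d = 4 \<or> c = 1 \<and> d = 1 \<or> c = 1 \<and> d = 4 \<or> c = 5 \<and> d = 0 \<or> c = 5 \<and> d = 1"
        by simp
      have "x = s" using is_chain_arc_start[of d x w] dq cd unfolding q s by linarith
      then show ?thesis
        using d[OF \<open>x = s\<close>] c cd s m n by (elim disjE conjE) simp_all
    qed
    moreover have "v = s" "\<not> (d = c \<and> q = Suc p)" using 1 s e q by auto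
    ultimately show ?thesis using e by blast
  next
    case 2
    then have e: "Suc p = chain_len l m n c" using is_chain_arc_end_iff[OF cp] by blast
    obtain s where s: "s = m + l" by simp
    have c: "c = 2 \<and> u = s + n \<or> c = 3 \<and> u = s + 1 \<or> c = 4 \<and> u = s - 1"
      using is_chain_arc_into_ml[of c p u] cp 2 unfolding s by blast
    have d: "d = 2 \<and> q = 0 \<and> w = s + 1 \<or> d = 3 \<and> q = 0 \<and> w = s + n \<or> d = 5 \<and> q = 0 \<and> w = s - 1"
      if "x = s"
      using is_chain_arc_from_ml[of d q w] dq that unfolding s by blast
    have "q = 0 \<and> (c, d) \<in> chain_succ" if "x = s" "w \<noteq> u"
      using d[OF that(1)] c that(2) by (elim disjE conjE) (simp_all add: chain_succ_def)
    moreover have "x = s \<and> w \<noteq> u" if q: "q = 0" and "(c, d) \<in> chain_succ"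
    proof -
      have c': "c = 2 \<or> c = 3 \<or> c = 4" using c by blast
      have "(c, d) \<in> {(2,2), (2,5), (3,3), (3,5), (4,2), (4,3)}"
        using c' that(2) unfolding chain_succ_def by (elim disjE) simp_all
      then have cd: "c = 2 \<and> d = 2 \<or> c = 2 \<and> d = 5 \<or> c = 3 \<and> d = 3 \<or> c = 3 \<and> d = 5 \<or> c = 4 \<and> d = 2 \<or> c = 4 \<and> d = 3"
        by simp
      have "x = s" using is_chain_arc_start[of d x w] dq cd unfolding q s by linarith
      then show ?thesis
        using d[OF \<open>x = s\<close>] c cd s m n by (elim disjE conjE) simp_all
    qed
    moreover have "v = s" "\<not> (d = c \<and> q = Suc p)" using 2 s e q by auto
    ultimately show ?thesis using e by blast
  next
    case 3
    then show ?thesis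
      using is_chain_arc_end_iff[OF cp] is_chain_arc_next[OF cp, of d q w] is_chain_arc_Suc[OF cp] dq
      by blast
  qed
qed

section \<open>Adjacency and degrees in the barbell\<close>

lemma cb_edge_dir_iff:
  "cb_edge_dir (Suc l) (Suc m) (Suc n) u v \<longleftrightarrow>
    u = m \<and> v = 0 \<or> u < m + l + n \<and> v = Suc u \<or> u = m + l + n \<and> v = m + l"
proof -
  have *: "Suc m + Suc l - 2 = m + l" "Suc m + Suc l + Suc n - 2 = Suc (m + l + n)" by simp_all
  \<comment> \<open>Labels increase along the first cycle, the path and the second cycle in turn;
    \<open>mod\<close> wraps only at \<open>m\<close> and \<open>m + l + n\<close>, the two closing
    edges.\<close>
  consider "u < m" | "u = m" | "m < u" "u < m + l" | "m + l \<le> u" "u < m + l + n" | "u = m + l + n" | "u > m + l + n"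
    by linarith
  then show ?thesis
    unfolding cb_edge_dir_def * using m n l by cases auto
qed

lemma cb_adj_iff_is_chain_arc:
  "cb_adj (Suc l) (Suc m) (Suc n) u v \<longleftrightarrow> (\<exists>c p. is_chain_arc l m n c p u v)"
proof
  have up: "\<exists>c p. is_chain_arc l m n c p u v" if "u < m + l + n" "v = Suc u"
  proof -
    consider "u < m" | "m \<le> u" "u < m + l" | "m + l \<le> u" by linarith
    \<comment> \<open>In chain 0 the position is \<open>v\<close> rather than \<open>u\<close>,
      because the closing arc occupies position 0.\<close>
    then have "is_chain_arc l m n 0 v u v \<or> is_chain_arc l m n 4 (u - m) u v
        \<or> is_chain_arc l m n 2 (u - (m + l)) u v"
      using that by cases (simp_all add: is_chain_arc_iff less_diff_conv2)
    then show ?thesis by blast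
  qed
  have down: "\<exists>c p. is_chain_arc l m n c p u v" if "v < m + l + n" "u = Suc v"
  proof -
    consider "v < m" | "m \<le> v" "v < m + l" | "m + l \<le> v" by linarith
    \<comment> \<open>The same shift occurs in chain 3, which also begins with its closing
      arc.\<close>
    then have "is_chain_arc l m n 1 (m - u) u v \<or> is_chain_arc l m n 5 (m + l - u) u v
        \<or> is_chain_arc l m n 3 (m + l + n - v) u v"
      using that by cases (simp_all add: is_chain_arc_iff less_diff_conv2)
    then show ?thesis by blast
  qed
  have closing: "is_chain_arc l m n 0 0 m 0" "is_chain_arc l m n 1 m 0 m"
      "is_chain_arc l m n 2 n (m + l + n) (m + l)" "is_chain_arc l m n 3 0 (m + l) (m + l + n)"
    unfolding is_chain_arc_iff by simp_all
  assume "cb_adj (Suc l) (Suc m) (Suc n) u v"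
  then show "\<exists>c p. is_chain_arc l m n c p u v"
    unfolding cb_adj_def cb_edge_dir_iff
    by (elim disjE conjE) (use up down closing in blast)+
next
  assume "\<exists>c p. is_chain_arc l m n c p u v"
  then obtain c p where "is_chain_arc l m n c p u v" by blast
  then show "cb_adj (Suc l) (Suc m) (Suc n) u v"
    unfolding is_chain_arc_iff cb_adj_def cb_edge_dir_iff using m n l
    by - (elim disjE conjE; simp)
qed

lemma cb_adj_in_vertices:
  assumes "cb_adj (Suc l) (Suc m) (Suc n) u v"
  shows "u \<in> cb_vertices (Suc l) (Suc m) (Suc n)" "v \<in> cb_vertices (Suc l) (Suc m) (Suc n)"
  using assms unfolding cb_adj_def cb_edge_dir_iff by (auto simp: cb_vertices_def)

lemma gdeg_cb:
  assumes "v \<in> cb_vertices (Suc l) (Suc m) (Suc n)"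
  shows "gdeg (cb_vertices (Suc l) (Suc m) (Suc n)) (cb_adj (Suc l) (Suc m) (Suc n)) v =
    (if v = m \<or> v = m + l then 3 else 2)"
proof -
  let ?N = "{w \<in> cb_vertices (Suc l) (Suc m) (Suc n). cb_adj (Suc l) (Suc m) (Suc n) v w}"
  have N: "?N = {w. cb_adj (Suc l) (Suc m) (Suc n) v w}"
    using cb_adj_in_vertices by blast
  have "v \<le> m + l + n" using assms by (simp add: cb_vertices_def)
  \<comment> \<open>The extreme labels are separate cases: one of their two neighbours lies across a
    closing edge.\<close>
  then consider "v = 0" | "0 < v" "v < m + l + n" "v \<noteq> m" "v \<noteq> m + l" | "v = m" | "v = m + l"
    | "v = m + l + n"
    by linarith
  then show ?thesis
  proof cases
    case 1
    then have "?N = {1, m}" unfolding N unfolding cb_adj_def cb_edge_dir_iff using m n l by auto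
    then show ?thesis using 1 m l by (simp add: gdeg_def)
  next
    case 2
    then have "?N = {v - 1, v + 1}" unfolding N unfolding cb_adj_def cb_edge_dir_iff using m n l by auto
    then show ?thesis using 2 by (simp add: gdeg_def)
  next
    case 3
    then have "?N = {0, m - 1, m + 1}" unfolding N unfolding cb_adj_def cb_edge_dir_iff using m n l by auto
    then show ?thesis using 3 m by (simp add: gdeg_def)
  next
    case 4
    then have "?N = {m + l - 1, m + l + 1, m + l + n}" unfolding N unfolding cb_adj_def cb_edge_dir_iff using m n l by auto
    moreover have "card {m + l - 1, m + l + 1, m + l + n} = 3" using n l by (cases l) (simp_all add: card_insert_if)
    ultimately show ?thesis using 4 by (simp add: gdeg_def)
  next
    case 5
    then have "?N = {m + l, m + l + n - 1}" unfolding N unfolding cb_adj_def cb_edge_dir_iff using m n l by auto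
    moreover have "card {m + l, m + l + n - 1} = 2" using n by (simp add: card_insert_if)
    ultimately show ?thesis using 5 n l by (simp add: gdeg_def)
  qed
qed

section \<open>Enumeration of the arcs and the characteristic polynomial\<close>

lemma block_offset_chain_len: "block_offset (chain_len l m n) 6 = 2 * (Suc m + Suc n + l)"
  by (simp add: block_offset_def chain_len_def eval_nat_numeral)

text \<open>Every arc lies on some chain, which gives surjectivity; it determines its chain and
  position, hence its index, which gives injectivity.\<close>

lemma bij_betw_chain_arc:
  "bij_betw (\<lambda>i. chain_arc l m n (block_of (chain_len l m n) i) (block_pos (chain_len l m n) i))
    {0..<2 * (Suc m + Suc n + l)}
    (arcs (cb_vertices (Suc l) (Suc m) (Suc n)) (cb_adj (Suc l) (Suc m) (Suc n)))"
    (is "bij_betw ?f ?I ?A")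
proof -
  let ?ch = "block_of (chain_len l m n)" and ?pos = "block_pos (chain_len l m n)"
  have arc: "is_chain_arc l m n (?ch i) (?pos i) (fst (?f i)) (snd (?f i))" if "i \<in> ?I" for i
    using block_decomposition[of i "chain_len l m n" 6] that
    by (simp add: is_chain_arc_def block_offset_chain_len)
  have dec: "block_offset (chain_len l m n) (?ch i) + ?pos i = i" if "i \<in> ?I" for i
    by (rule block_decomposition(3)[of _ _ 6]) (use that in \<open>simp add: block_offset_chain_len\<close>)
  have A: "?A = {(u, v). \<exists>c p. is_chain_arc l m n c p u v}"
    unfolding cb_adj_iff_is_chain_arc[symmetric] arcs_def
    using cb_adj_in_vertices by blast
  have "?f ` ?I = ?A"
  proof (intro equalityI subsetI)
    fix y assume "y \<in> ?f ` ?I"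
    then obtain i where i: "i \<in> ?I" "y = ?f i" by blast
    then have "\<exists>c p. is_chain_arc l m n c p (fst y) (snd y)" using arc by blast
    then show "y \<in> ?A" unfolding A by (simp add: case_prod_unfold)
  next
    fix y assume "y \<in> ?A"
    then obtain c p where cp: "c < 6" "p < chain_len l m n c" "chain_arc l m n c p = y"
      unfolding A is_chain_arc_def by auto
    let ?i = "block_offset (chain_len l m n) c + p"
    have "?i < block_offset (chain_len l m n) (Suc c)" using cp by (simp add: block_offset_Suc)
    also have "\<dots> \<le> block_offset (chain_len l m n) 6" using cp by (intro block_offset_mono) simp
    finally have "?i \<in> ?I" by (simp add: block_offset_chain_len)
    then show "y \<in> ?f ` ?I"
      using cp by (intro image_eqI[of _ _ ?i]) (simp_all add: block_of_offset_plus)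
  qed
  moreover have "inj_on ?f ?I"
  proof (rule inj_onI)
    fix i j assume ij: "i \<in> ?I" "j \<in> ?I" "?f i = ?f j"
    have "is_chain_arc l m n (?ch j) (?pos j) (fst (?f i)) (snd (?f i))"
      using arc[OF ij(2)] by (simp only: ij(3))
    then have eq: "?ch i = ?ch j" "?pos i = ?pos j"
      using is_chain_arc_inj[OF arc[OF ij(1)]] by blast+
    show "i = j" using dec[OF ij(1)] dec[OF ij(2)] unfolding eq by simp
  qed
  ultimately show ?thesis unfolding bij_betw_def by blast
qed

text \<open>The lexicographic order of the arcs is exchanged for the chain order, and the
  contraction applies. It divides by powers of \<open>x\<close>, hence the restriction to nonzero
  \<open>x\<close>.\<close>

lemma poly_char_poly_cb:
  fixes x :: complex
  assumes x: "x \<noteq> 0"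
  defines "A \<equiv> map_mat complex_of_real
    (nb_matrix (cb_vertices (Suc l) (Suc m) (Suc n)) (cb_adj (Suc l) (Suc m) (Suc n)))"
  defines "u \<equiv> (x ^ Suc m - 1/2) * (x ^ Suc n - 1/2)"
  shows "poly (char_poly A) x = u * (u * x ^ (2 * l) - 1/4)"
proof -
  let ?V = "cb_vertices (Suc l) (Suc m) (Suc n)" and ?E = "cb_adj (Suc l) (Suc m) (Suc n)"
  let ?len = "chain_len l m n"
  define N where "N = 2 * (Suc m + Suc n + l)"
  define L where "L = sorted_list_of_set (arcs ?V ?E)"
  define ch where "ch = block_of ?len"
  define pos where "pos = block_pos ?len"
  define f where "f i = chain_arc l m n (ch i) (pos i)" for i
  define F where "F e e' = (if fst e' = snd e \<and> snd e' \<noteq> fst e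
      then 1 / (complex_of_nat (gdeg ?V ?E (snd e)) - 1) else 0)" for e e' :: "nat \<times> nat"
  define T where "T c d = (if (c, d) \<in> chain_succ then 1 / 2 else 0 :: complex)" for c d
  have f: "bij_betw f {0..<N} (arcs ?V ?E)"
    using bij_betw_chain_arc unfolding f_def ch_def pos_def N_def .
  then have fin: "finite (arcs ?V ?E)" and card: "card (arcs ?V ?E) = N"
    using bij_betw_finite bij_betw_same_card by fastforce+
  then have L: "distinct L" "set L = arcs ?V ?E" "length L = N"
    by (simp_all add: L_def)
  then have g: "bij_betw ((!) L) {0..<N} (arcs ?V ?E)"
    using bij_betw_nth[of L "{0..<N}"] by (simp add: atLeast0LessThan)
  have A: "A \<in> carrier_mat N N" "\<And>i j. i < N \<Longrightarrow> j < N \<Longrightarrow> A $$ (i, j) = F (L ! i) (L ! j)"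
    using L(3) by (auto simp: A_def nb_matrix_def Let_def F_def case_prod_unfold simp flip: L_def)
  have arc: "is_chain_arc l m n (ch i) (pos i) (fst (f i)) (snd (f i))" if "i < N" for i
    using block_decomposition[of i ?len 6] that
    by (simp add: is_chain_arc_def block_offset_chain_len f_def ch_def pos_def N_def)
  have FT: "F (f i) (f j) = (if ch j = ch i \<and> pos j = Suc (pos i) then 1 else 0)
      + (if Suc (pos i) = ?len (ch i) \<and> pos j = 0 then T (ch i) (ch j) else 0)"
    if ij: "i < N" "j < N" for i j
  proof -
    have "f i \<in> arcs ?V ?E" using f ij by (auto simp: bij_betw_def)
    then have "snd (f i) \<in> ?V" by (auto simp: arcs_def)
    then have deg: "gdeg ?V ?E (snd (f i)) = (if Suc (pos i) = ?len (ch i) then 3 else 2)"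
      using gdeg_cb is_chain_arc_end_iff[OF arc[OF ij(1)]] by simp
    \<comment> \<open>If \<open>j\<close> follows \<open>i\<close> inside a chain, then
      \<open>i\<close> is not last there, so its head has degree 2 and the entry is 1.\<close>
    have "pos j < ?len (ch j)" using arc[OF ij(2)] by (simp add: is_chain_arc_def)
    then show ?thesis
      using chain_transition_iff[OF arc[OF ij(1)] arc[OF ij(2)]] deg
      unfolding F_def T_def by auto
  qed
  have "poly (char_poly A) x = det (x \<cdot>\<^sub>m 1\<^sub>m N - A)"
    by (rule poly_char_poly[OF A(1)])
  also have "x \<cdot>\<^sub>m 1\<^sub>m N - A = mat N N (\<lambda>(i,j). (if L ! i = L ! j then x else 0) - F (L ! i) (L ! j))"
    using A L by (intro eq_matI) (auto simp: nth_eq_iff_index_eq)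
  also have "det \<dots> = det (mat N N (\<lambda>(i,j). (if f i = f j then x else 0) - F (f i) (f j)))"
    by (rule det_reindex[OF g f, where F = "\<lambda>e e'. (if e = e' then x else 0) - F e e'"])
  also have "mat N N (\<lambda>(i,j). (if f i = f j then x else 0) - F (f i) (f j))
    = mat N N (\<lambda>(i,j). (if i = j then x else 0)
      - (if ch j = ch i \<and> pos j = Suc (pos i) then 1 else 0)
      - (if Suc (pos i) = ?len (ch i) \<and> pos j = 0 then T (ch i) (ch j) else 0))"
    using bij_betw_imp_inj_on[OF f] by (intro eq_matI) (simp_all add: FT inj_on_eq_iff)
  also have "det \<dots> = x ^ N * det (mat 6 6 (\<lambda>(c,d). (if c = d then 1 else 0) - T c d / x ^ ?len c))"
    unfolding ch_def pos_def N_def block_offset_chain_len[symmetric] using l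
    by (intro det_blocks_contraction[OF x]) (simp add: chain_len_def)
  also have "mat 6 6 (\<lambda>(c,d). (if c = d then 1 else 0) - T c d / x ^ ?len c)
    = mat 6 6 (\<lambda>(c,d). (if c = d then 1 else 0) - (if (c,d) \<in> chain_succ then 1 / (2 * x ^ ?len c) else 0))"
    by (intro eq_matI) (simp_all add: T_def)
  also have "x ^ N * det \<dots> = u * (u * x ^ (2 * l) - 1/4)"
  proof -
    define X Y Z where "X = x ^ Suc m" and "Y = x ^ Suc n" and "Z = x ^ l"
    have nz: "X \<noteq> 0" "Y \<noteq> 0" "Z \<noteq> 0" using x by (simp_all add: X_def Y_def Z_def)
    have N: "x ^ N = X^2 * Y^2 * Z^2" "x ^ (2 * l) = Z^2"
      by (simp_all only: N_def X_def Y_def Z_def power_mult[symmetric] power_add[symmetric])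
        (simp_all add: algebra_simps)
    \<comment> \<open>With chain weights w c = 1 / (2 x^len c), these are 1 - w 0, 1 - w 2 and 4 (w
      0) (w 2) (w 4) (w 5). The factor \<open>x ^ N\<close> clears all denominators.\<close>
    define p q r where "p = 1 - 1 / (2 * X)" and "q = 1 - 1 / (2 * Y)"
      and "r = 4 * (1 / (2 * X)) * (1 / (2 * Y)) * (1 / (2 * Z)) * (1 / (2 * Z))"
    have "X * p = X - 1/2" "Y * q = Y - 1/2"
      using nz unfolding p_def q_def by (simp_all add: right_diff_distrib)
    then have u: "u = (X * p) * (Y * q)" unfolding u_def X_def Y_def by simp
    have r: "X * Y * Z^2 * r = 1/4"
      using nz unfolding r_def by (simp add: power2_eq_square)
    have det: "det (mat 6 6 (\<lambda>(c,d). (if c = d then 1 else 0)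
        - (if (c,d) \<in> chain_succ then 1 / (2 * x ^ ?len c) else 0))) = p * q * (p * q - r)"
      by (subst det_contracted_chains) (simp_all add: chain_len_def p_def q_def r_def X_def Y_def Z_def)
    have "X^2 * Y^2 * Z^2 * (p * q * (p * q - r)) = X * p * (Y * q) * (X * p * (Y * q) * Z^2 - X * Y * Z^2 * r)"
      by (simp add: power2_eq_square algebra_simps)
    then show ?thesis
      unfolding det N u r .
  qed
  finally show ?thesis .
qed

end

section \<open>Kemeny's constant\<close>

definition cb_char_poly :: "nat \<Rightarrow> nat \<Rightarrow> nat \<Rightarrow> complex poly" where
  "cb_char_poly l a b =
    (let u = (monom 1 a - [:1/2:]) * (monom 1 b - [:1/2:]) in u * (u * monom 1 (2 * l) - [:1/4:]))"

text \<open>This recovers the point 0 that the contraction excludes: a nonzero polynomial has only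
  finitely many roots.\<close>

lemma poly_eqI_nonzero:
  fixes p q :: "'a :: {idom, ring_char_0} poly"
  assumes "\<And>x. x \<noteq> 0 \<Longrightarrow> poly p x = poly q x"
  shows "p = q"
proof (rule ccontr)
  assume "p \<noteq> q"
  then have "finite {x. poly (p - q) x = 0}" by (intro poly_roots_finite) simp
  moreover have "UNIV - {0} \<subseteq> {x. poly (p - q) x = 0}" using assms by auto
  ultimately have "finite (UNIV - {0 :: 'a})" using finite_subset by blast
  then show False using infinite_UNIV_char_0[where 'a = 'a] by simp
qed

text \<open>With v = x^(2 l) the polynomial is u (u v - 1/4), whose second factor vanishes at 1. The
  first derivative there is the number of edges over 8.\<close>

lemma cb_char_poly_derivs:
  fixes a b l :: nat
  assumes "a \<ge> 1" "b \<ge> 1" "l \<ge> 1"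
  defines "A \<equiv> complex_of_nat a" and "B \<equiv> complex_of_nat b" and "C \<equiv> complex_of_nat l"
  shows "poly (cb_char_poly l a b) 1 = 0"
    and "poly (pderiv (cb_char_poly l a b)) 1 = (A + B + C) / 8"
    and "poly (pderiv (pderiv (cb_char_poly l a b))) 1 =
      (5 * (A + B)^2 + 2 * A * B + 8 * (A + B) * C + 2 * C^2 - (A + B + C)) / 8"
proof -
  define u v where "u = (monom 1 a - [:1/2:]) * (monom 1 b - [:1/2:] :: complex poly)"
    and "v = (monom 1 (2 * l) :: complex poly)"
  have p: "cb_char_poly l a b = u * (u * v - [:1/4:])"
    by (simp add: cb_char_poly_def u_def v_def Let_def)
  \<comment> \<open>The exponents after one differentiation; positivity makes the subtractions
    exact.\<close>
  have nat: "complex_of_nat (a - Suc 0) = A - 1" "complex_of_nat (b - Suc 0) = B - 1"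
      "complex_of_nat (2 * l - Suc 0) = 2 * C - 1"
    using assms by simp_all
  note defs = pderiv_mult pderiv_diff pderiv_add pderiv_monom pderiv_pCons poly_monom nat
  have u: "poly u 1 = 1/4" "poly (pderiv u) 1 = (A + B) / 2"
      "poly (pderiv (pderiv u)) 1 = (A * (A - 1) + B * (B - 1)) / 2 + 2 * A * B"
    by (simp_all add: u_def defs flip: A_def B_def)
  have v: "poly v 1 = 1" "poly (pderiv v) 1 = 2 * C" "poly (pderiv (pderiv v)) 1 = 2 * C * (2 * C - 1)"
    by (simp_all add: v_def defs flip: C_def)
  show "poly (cb_char_poly l a b) 1 = 0"
    by (simp add: p u v)
  show "poly (pderiv (cb_char_poly l a b)) 1 = (A + B + C) / 8"
    unfolding p by (simp add: pderiv_mult pderiv_diff pderiv_pCons u v)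
  \<comment> \<open>The second derivative of u^2 v - u/4 at 1: the first two summands are (u^2)'' v,
    then follow 2 (u^2)' v', u^2 v'' and -u''/4.\<close>
  have "poly (pderiv (pderiv (cb_char_poly l a b))) 1 =
      2 * ((A + B) / 2)^2 + (1/2) * ((A * (A - 1) + B * (B - 1)) / 2 + 2 * A * B)
      + (A + B) / 2 * (2 * C) + 2 * C * (2 * C - 1) / 16
      - ((A * (A - 1) + B * (B - 1)) / 2 + 2 * A * B) / 4"
    unfolding p by (simp add: pderiv_mult pderiv_diff pderiv_add pderiv_pCons u v power2_eq_square) (simp add: field_simps)
  also have "\<dots> = (5 * (A + B)^2 + 2 * A * B + 8 * (A + B) * C + 2 * C^2 - (A + B + C)) / 8"
    by (simp add: power2_eq_square field_simps)
  finally show "poly (pderiv (pderiv (cb_char_poly l a b))) 1 =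
      (5 * (A + B)^2 + 2 * A * B + 8 * (A + B) * C + 2 * C^2 - (A + B + C)) / 8" .
qed

theorem theorem5p5:
  fixes a b k :: nat
  assumes "a \<ge> 3" and "b \<ge> 3" and "k \<ge> 2"
  shows "kemeny_nb (cb_vertices k a b) (cb_adj k a b) =
    complex_of_real
     ((2 * (real a + real b + real k - 1)^2 + 3 * (real a + real b)^2 + 2 * real a * real b
       + 4 * (real a + real b) * (real k - 1) - (real a + real b + real k - 1))
      / (2 * (real a + real b + real k - 1)))"
proof -
  obtain m n l where mnl: "a = Suc m" "b = Suc n" "k = Suc l"
    using assms by (metis One_nat_def Suc_le_D numeral_2_eq_2 numeral_3_eq_3)
  then have ge: "m \<ge> 2" "n \<ge> 2" "l \<ge> 1" using assms by simp_all
  define P where "P = map_mat complex_of_real (nb_matrix (cb_vertices k a b) (cb_adj k a b))"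
  have char_poly_P: "char_poly P = cb_char_poly l a b"
  proof (rule poly_eqI_nonzero)
    fix x :: complex assume "x \<noteq> 0"
    then show "poly (char_poly P) x = poly (cb_char_poly l a b) x"
      unfolding P_def mnl poly_char_poly_cb[OF ge \<open>x \<noteq> 0\<close>]
      by (simp only: cb_char_poly_def Let_def poly_mult poly_diff poly_monom poly_pCons poly_0
          mult_1_left mult_zero_right add_0_right)
  qed
  define A B C where "A = complex_of_nat a" and "B = complex_of_nat b" and "C = complex_of_nat l"
  have "a \<ge> 1" "b \<ge> 1" using mnl by simp_all
  note derivs = cb_char_poly_derivs[OF this ge(3), folded A_def B_def C_def]
  \<comment> \<open>The edge count is positive as a natural number, so 1 is a simple root.\<close>
  have "complex_of_nat (a + b + l) \<noteq> 0" unfolding of_nat_eq_0_iff using mnl by simp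
  then have nz: "A + B + C \<noteq> 0" by (simp add: A_def B_def C_def)
  have cancel: "(x / 8) / (2 * (y / 8)) = x / (2 * y)" for x y :: complex by simp
  have "kemeny P = poly (pderiv (pderiv (cb_char_poly l a b))) 1 / (2 * poly (pderiv (cb_char_poly l a b)) 1)"
    unfolding kemeny_def char_poly_P
    by (rule sum_proots_inverse_diff_simple_root) (use nz in \<open>simp_all add: derivs\<close>)
  also have "\<dots> =
      (5 * (A + B)^2 + 2 * A * B + 8 * (A + B) * C + 2 * C^2 - (A + B + C)) / (2 * (A + B + C))"
    unfolding derivs cancel ..
  \<comment> \<open>With s = A + B and C = k - 1, the identity is 2 (s + C)^2 + 3 s^2 + 4 s C = 5
    s^2 + 8 s C + 2 C^2; the other terms agree.\<close>
  also have "5 * (A + B)^2 + 2 * A * B + 8 * (A + B) * C + 2 * C^2 - (A + B + C) = complex_of_real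
     (2 * (real a + real b + real k - 1)^2 + 3 * (real a + real b)^2 + 2 * real a * real b
       + 4 * (real a + real b) * (real k - 1) - (real a + real b + real k - 1))"
    by (simp add: A_def B_def C_def mnl(3) power2_eq_square algebra_simps)
  also have "2 * (A + B + C) = complex_of_real (2 * (real a + real b + real k - 1))"
    by (simp add: A_def B_def C_def mnl(3))
  finally show ?thesis unfolding kemeny_nb_def P_def[symmetric] of_real_divide .
qed

end
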